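(* Let $k\ge 1$, $s\ge 2$, and consider a core method with $k$ steps and $s$ stages for $u_t=F(u)$, with coefficients $\check d_{i\ell}$ ($2\le i\le s$, $1\le \ell\le k$), $\hat a_{i\ell}$ ($2\le i\le s$, $1\le \ell\le k-1$), $a_{ij}$ ($2\le i\le s$, $1\le j\le s$): $$y^{(1)}=u^n,$$ $$y^{(i)}=\sum_{\ell=1}^{k}\check d_{i\ell}\,u^{n-k+\ell}+\Delta t\sum_{\ell=1}^{k-1}\hat a_{i\ell}F(u^{n-k+\ell})+\Delta t\sum_{j=1}^{s}a_{ij}F(y^{(j)}),\quad 2\le i\le s,$$ $$u^{n+1}=y^{(s)}.$$ Let the core method be filtered (in the sense defined in the context) with pre-filter coefficients $d_{1\ell}$ ($1\le\ell\le k$) and post-filter coefficients $\theta_\ell$ ($1\le \ell\le k$), $\hat b_\ell$ ($1\le\ell\le k-1$), $b_j$ ($1\le j\le s$). These filter coefficients do not depend on the coefficients of the core method and may be chosen freely (subject only to whatever order and stability constraints one wishes to impose). Then the filtered method is a general linear method with $k$ steps and $s$ stages, in which: (1) the first stage is the pre-filter $$y^{(1)}=\sum_{\ell=1}^{k}d_{1\ell}\,u^{n-k+\ell};$$ (2) the final update is the post-filter $$u^{n+1}=\sum_{\ell=1}^{k}\theta_\ell u^{n-k+\ell}+\Delta t\sum_{\ell=1}^{k-1}\hat b_\ell F(u^{n-k+\ell})+\Delta t\sum_{j=1}^{s}b_jF(y^{(j)});$$ (3) the middle stages, $2\le i\le s$, have the form $$y^{(i)}=\sum_{\ell=1}^{k}d_{i\ell}\,u^{n-k+\ell}+\Delta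 t\sum_{\ell=1}^{k-1}\hat a_{i\ell}F(u^{n-k+\ell})+\Delta t\sum_{j=1}^{s}a_{ij}F(y^{(j)}),$$ where the coefficients $a_{ij}$ and $\hat a_{i\ell}$ are the same as those of the core method, and $$d_{i\ell}=\check d_{ik}\,d_{1\ell}+\check d_{i\ell}\quad\text{for }\ell=1,\dots,k-1,\qquad d_{ik}=\check d_{ik}\,d_{1k}.$$
   Context: A general linear method (GLM) with $s$ stages and $k$ steps for $u_t=F(u)$ with time step $\Delta t$ is a method of the form $$y^{(i)}=\sum_{\ell=1}^{k}d_{i\ell}u^{n-k+\ell}+\Delta t\sum_{\ell=1}^{k-1}\hat a_{i\ell}F(u^{n-k+\ell})+\Delta t\sum_{j=1}^{s}a_{ij}F(y^{(j)}),\quad 1\le i\le s,$$ $$u^{n+1}=\sum_{\ell=1}^{k}\theta_\ell u^{n-k+\ell}+\Delta t\sum_{\ell=1}^{k-1}\hat b_\ell F(u^{n-k+\ell})+\Delta t\sum_{j=1}^{s}b_jF(y^{(j)}),$$ where $u^{n-k+\ell}$ are the steps (previous solution values) and $y^{(i)}$ are the intermediate stages. Filtering the core method means the following. Pre-filtering: the first stage $y^{(1)}=u^n$ is replaced by the linear combination $y^{(1)}=\sum_{\ell=1}^k d_{1\ell}u^{n-k+\ell}$, and in every stage $2\le i\le s$ the value $u^n$ (the $\ell=k$ term $\check d_{ik}u^n$ of the first sum) is replaced by $y^{(1)}$; the remaining terms of the stage equations keep their form (with $F(y^{(1)})$ evaluated at the new $y^{(1)}$). Post-filtering: the final line $u^{n+1}=y^{(s)}$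 is replaced by $u^{n+1}=\sum_{\ell=1}^{k}\theta_\ell u^{n-k+\ell}+\Delta t\sum_{\ell=1}^{k-1}\hat b_\ell F(u^{n-k+\ell})+\Delta t\sum_{j=1}^{s}b_jF(y^{(j)})$. *)

theory Defs imports Complex_Main begin

text \<open>Coefficients are real functions of indices starting at 1, as in the usual tableau
  notation; only the entries in the index ranges of the step relations below are ever used. In all
  step relations \<open>u :: int \<Rightarrow> 'v\<close> is the sequence of numerical solution values
  (\<open>u n\<close> for $u^n$), \<open>y i\<close> is the \<open>i\<close>-th stage, and the relation says that the stages
  \<open>y 1, \<dots>, y s\<close> and the new value \<open>u (n + 1)\<close> satisfy the (possibly implicit) equations
  of one step of the method for $u_t = F(u)$ with time step \<open>dt\<close>.\<close>

record glm =
  glm_d :: "nat \<Rightarrow> nat \<Rightarrow> real"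
  glm_ahat :: "nat \<Rightarrow> nat \<Rightarrow> real"
  glm_a :: "nat \<Rightarrow> nat \<Rightarrow> real"
  glm_theta :: "nat \<Rightarrow> real"
  glm_bhat :: "nat \<Rightarrow> real"
  glm_b :: "nat \<Rightarrow> real"

definition glm_step ::
  "nat \<Rightarrow> nat \<Rightarrow> glm \<Rightarrow> ('v::real_vector \<Rightarrow> 'v) \<Rightarrow> real \<Rightarrow> (int \<Rightarrow> 'v) \<Rightarrow> int \<Rightarrow> (nat \<Rightarrow> 'v) \<Rightarrow> bool"
where
  "glm_step k s G F dt u n y \<longleftrightarrow>
    (\<forall>i\<in>{1..s}. y i =
        (\<Sum>l=1..k. glm_d G i l *\<^sub>R u (n - int k + int l))
      + dt *\<^sub>R (\<Sum>l=1..k-1. glm_ahat G i l *\<^sub>R F (u (n - int k + int l)))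
      + dt *\<^sub>R (\<Sum>j=1..s. glm_a G i j *\<^sub>R F (y j))) \<and>
    u (n + 1) =
        (\<Sum>l=1..k. glm_theta G l *\<^sub>R u (n - int k + int l))
      + dt *\<^sub>R (\<Sum>l=1..k-1. glm_bhat G l *\<^sub>R F (u (n - int k + int l)))
      + dt *\<^sub>R (\<Sum>j=1..s. glm_b G j *\<^sub>R F (y j))"

record core_method =
  core_d :: "nat \<Rightarrow> nat \<Rightarrow> real"
  core_ahat :: "nat \<Rightarrow> nat \<Rightarrow> real"
  core_a :: "nat \<Rightarrow> nat \<Rightarrow> real"

text \<open>Right-hand side of stage \<open>i\<close> of a core method, with \<open>w\<close> in place of the value $u^n$ in
  the term \<open>l = k\<close> of the first sum. The second sum stops at \<open>l = k - 1\<close>, so $u^n$ does not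
  occur elsewhere.\<close>

definition core_stage ::
  "nat \<Rightarrow> nat \<Rightarrow> core_method \<Rightarrow> ('v::real_vector \<Rightarrow> 'v) \<Rightarrow> real \<Rightarrow> (int \<Rightarrow> 'v) \<Rightarrow> int \<Rightarrow> (nat \<Rightarrow> 'v)
    \<Rightarrow> 'v \<Rightarrow> nat \<Rightarrow> 'v"
where
  "core_stage k s C F dt u n y w i =
        (\<Sum>l=1..k. core_d C i l *\<^sub>R (if l = k then w else u (n - int k + int l)))
      + dt *\<^sub>R (\<Sum>l=1..k-1. core_ahat C i l *\<^sub>R F (u (n - int k + int l)))
      + dt *\<^sub>R (\<Sum>j=1..s. core_a C i j *\<^sub>R F (y j))"

definition core_step ::
  "nat \<Rightarrow> nat \<Rightarrow> core_method \<Rightarrow> ('v::real_vector \<Rightarrow> 'v) \<Rightarrow> real \<Rightarrow> (int \<Rightarrow> 'v) \<Rightarrow> int \<Rightarrow> (nat \<Rightarrow> 'v) \<Rightarrow> bool"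
where
  "core_step k s C F dt u n y \<longleftrightarrow>
    y 1 = u n \<and>
    (\<forall>i\<in>{2..s}. y i = core_stage k s C F dt u n y (u n) i) \<and>
    u (n + 1) = y s"

record glm_filter =
  pre_d :: "nat \<Rightarrow> real"
  post_theta :: "nat \<Rightarrow> real"
  post_bhat :: "nat \<Rightarrow> real"
  post_b :: "nat \<Rightarrow> real"

text \<open>The filtered method differs from \<^const>\<open>core_step\<close> in three places: the first stage
  is the pre-filter, the first sum of the later stages uses \<open>y 1\<close> instead of \<open>u n\<close>, and
  the final update is the post-filter.\<close>

definition filtered_step ::
  "nat \<Rightarrow> nat \<Rightarrow> core_method \<Rightarrow> glm_filter \<Rightarrow> ('v::real_vector \<Rightarrow> 'v) \<Rightarrow> real \<Rightarrow> (int \<Rightarrow> 'v) \<Rightarrow> int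
    \<Rightarrow> (nat \<Rightarrow> 'v) \<Rightarrow> bool"
where
  "filtered_step k s C P F dt u n y \<longleftrightarrow>
    y 1 = (\<Sum>l=1..k. pre_d P l *\<^sub>R u (n - int k + int l)) \<and>
    (\<forall>i\<in>{2..s}. y i = core_stage k s C F dt u n y (y 1) i) \<and>
    u (n + 1) =
        (\<Sum>l=1..k. post_theta P l *\<^sub>R u (n - int k + int l))
      + dt *\<^sub>R (\<Sum>l=1..k-1. post_bhat P l *\<^sub>R F (u (n - int k + int l)))
      + dt *\<^sub>R (\<Sum>j=1..s. post_b P j *\<^sub>R F (y j))"

text \<open>With \<open>w = u n\<close> the stage is the one written with \<open>u (n - k + l)\<close> throughout.\<close>

lemma core_stage_unfiltered:
  "core_stage k s C F dt u n y (u n) i =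
        (\<Sum>l=1..k. core_d C i l *\<^sub>R u (n - int k + int l))
      + dt *\<^sub>R (\<Sum>l=1..k-1. core_ahat C i l *\<^sub>R F (u (n - int k + int l)))
      + dt *\<^sub>R (\<Sum>j=1..s. core_a C i j *\<^sub>R F (y j))"
  unfolding core_stage_def by (auto intro!: sum.cong)

end

theory Submission imports Defs begin

text \<open>Filtering touches a middle stage only through the single term
  $\check d_{ik} u^n$, which becomes $\check d_{ik} y^{(1)}$. Since $y^{(1)}$ is itself a linear
  combination $\sum_\ell d_{1\ell} u^{n-k+\ell}$ of the same steps, eliminating it leaves a linear
  combination of the steps, and collecting coefficients (\<open>sum_substitute_last\<close>) gives
  $\check d_{ik} d_{1\ell} + \check d_{i\ell}$ for $\ell < k$ and $\check d_{ik} d_{1k}$ for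
  $\ell = k$: at $\ell = k$ the core coefficient has been consumed by the substitution. The terms
  in \<open>F\<close> are left as they stand, so $a_{ij}$ and $\hat a_{i\ell}$ survive unchanged.

  The pre-filter is a stage of a general linear method without any evaluation of \<open>F\<close>, and
  the post-filter already has the shape of the final update. Hence the tableau
  \<open>filtered_glm\<close> has exactly the filtered steps as its steps.\<close>

text \<open>Distributing the last coefficient over the substituted combination adds
  \<open>c k * p l\<close> to every coefficient; the term \<open>c k\<close> itself disappears from the last
  position because \<open>v k\<close> was replaced.\<close>

lemma sum_substitute_last:
  fixes v :: "nat \<Rightarrow> 'v::real_vector"
  assumes "k \<ge> 1"
  shows "(\<Sum>l=1..k. c l *\<^sub>R (if l = k then \<Sum>m=1..k. p m *\<^sub>R v m else v l)) =
    (\<Sum>l=1..k. (if l = k then c k * p k else c k * p l + c l) *\<^sub>R v l)"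
proof -
  from assms obtain m where k: "k = Suc m"
    using not0_implies_Suc by fastforce
  have "(\<Sum>l=1..k. c l *\<^sub>R (if l = k then \<Sum>m=1..k. p m *\<^sub>R v m else v l)) =
      (\<Sum>l=1..m. c l *\<^sub>R v l) + c k *\<^sub>R (\<Sum>l=1..k. p l *\<^sub>R v l)"
    unfolding k by simp
  also have "\<dots> = (\<Sum>l=1..m. (c k * p l + c l) *\<^sub>R v l) + (c k * p k) *\<^sub>R v k"
    unfolding k by (simp add: scaleR_add_left scaleR_add_right scaleR_sum_right sum.distrib)
  also have "\<dots> = (\<Sum>l=1..k. (if l = k then c k * p k else c k * p l + c l) *\<^sub>R v l)"
    unfolding k by simp
  finally show ?thesis .
qed

definition filtered_glm :: "nat \<Rightarrow> core_method \<Rightarrow> glm_filter \<Rightarrow> glm" where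
  "filtered_glm k C P =
    \<lparr>glm_d = (\<lambda>i l. if i = 1 then pre_d P l
        else if l = k then core_d C i k * pre_d P k
        else core_d C i k * pre_d P l + core_d C i l),
     glm_ahat = (\<lambda>i l. if i = 1 then 0 else core_ahat C i l),
     glm_a = (\<lambda>i j. if i = 1 then 0 else core_a C i j),
     glm_theta = post_theta P,
     glm_bhat = post_bhat P,
     glm_b = post_b P\<rparr>"

lemma core_stage_pre_filter:
  assumes "k \<ge> 1" and "i \<ge> 2"
  shows "core_stage k s C F dt u n y (\<Sum>l=1..k. pre_d P l *\<^sub>R u (n - int k + int l)) i =
        (\<Sum>l=1..k. glm_d (filtered_glm k C P) i l *\<^sub>R u (n - int k + int l))
      + dt *\<^sub>R (\<Sum>l=1..k-1. core_ahat C i l *\<^sub>R F (u (n - int k + int l)))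
      + dt *\<^sub>R (\<Sum>j=1..s. core_a C i j *\<^sub>R F (y j))"
  using assms
    sum_substitute_last[of k "core_d C i" "pre_d P" "\<lambda>l. u (n - int k + int l)"]
  by (simp add: core_stage_def filtered_glm_def del: One_nat_def)

text \<open>The stages of the tableau \<open>filtered_glm\<close> split into the pre-filter, whose
  \<open>F\<close>-coefficients vanish, and the middle stages.\<close>

lemma glm_step_filtered_glm:
  assumes "s \<ge> 1"
  shows "glm_step k s (filtered_glm k C P) F dt u n y \<longleftrightarrow>
    y 1 = (\<Sum>l=1..k. pre_d P l *\<^sub>R u (n - int k + int l)) \<and>
    (\<forall>i\<in>{2..s}. y i =
        (\<Sum>l=1..k. glm_d (filtered_glm k C P) i l *\<^sub>R u (n - int k + int l))
      + dt *\<^sub>R (\<Sum>l=1..k-1. core_ahat C i l *\<^sub>R F (u (n - int k + int l)))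
      + dt *\<^sub>R (\<Sum>j=1..s. core_a C i j *\<^sub>R F (y j))) \<and>
    u (n + 1) =
        (\<Sum>l=1..k. post_theta P l *\<^sub>R u (n - int k + int l))
      + dt *\<^sub>R (\<Sum>l=1..k-1. post_bhat P l *\<^sub>R F (u (n - int k + int l)))
      + dt *\<^sub>R (\<Sum>j=1..s. post_b P j *\<^sub>R F (y j))"
proof -
  have "{1..s} = insert 1 {2..s}"
    using assms by auto
  then show ?thesis
    by (simp add: glm_step_def filtered_glm_def)
qed

text \<open>The middle stages may be rewritten because the pre-filter equation for \<open>y 1\<close> is
  one of the conjuncts on both sides.\<close>

lemma filtered_step_iff_glm_step:
  assumes "k \<ge> 1" and "s \<ge> 1"
  shows "filtered_step k s C P F dt u n y \<longleftrightarrow> glm_step k s (filtered_glm k C P) F dt u n y"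
  unfolding filtered_step_def glm_step_filtered_glm[OF assms(2)]
  using assms(1) by (auto simp: core_stage_pre_filter simp del: One_nat_def)

theorem theorem1:
  fixes k s :: nat and C :: core_method and P :: glm_filter
  assumes "k \<ge> 1" and "s \<ge> 2"
  shows "\<exists>G :: glm.
    (\<forall>(F :: 'v::real_vector \<Rightarrow> 'v) dt u n y.
      filtered_step k s C P F dt u n y \<longleftrightarrow> glm_step k s G F dt u n y) \<and>
    (\<forall>(F :: 'v \<Rightarrow> 'v) dt u n y.
      glm_step k s G F dt u n y \<longleftrightarrow>
        y 1 = (\<Sum>l=1..k. pre_d P l *\<^sub>R u (n - int k + int l)) \<and>
        (\<forall>i\<in>{2..s}. y i =
            (\<Sum>l=1..k. glm_d G i l *\<^sub>R u (n - int k + int l))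
          + dt *\<^sub>R (\<Sum>l=1..k-1. core_ahat C i l *\<^sub>R F (u (n - int k + int l)))
          + dt *\<^sub>R (\<Sum>j=1..s. core_a C i j *\<^sub>R F (y j))) \<and>
        u (n + 1) =
            (\<Sum>l=1..k. post_theta P l *\<^sub>R u (n - int k + int l))
          + dt *\<^sub>R (\<Sum>l=1..k-1. post_bhat P l *\<^sub>R F (u (n - int k + int l)))
          + dt *\<^sub>R (\<Sum>j=1..s. post_b P j *\<^sub>R F (y j))) \<and>
    (\<forall>l\<in>{1..k}. glm_d G 1 l = pre_d P l) \<and>
    (\<forall>l\<in>{1..k-1}. glm_ahat G 1 l = 0) \<and>
    (\<forall>j\<in>{1..s}. glm_a G 1 j = 0) \<and>
    (\<forall>l\<in>{1..k}. glm_theta G l = post_theta P l) \<and>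
    (\<forall>l\<in>{1..k-1}. glm_bhat G l = post_bhat P l) \<and>
    (\<forall>j\<in>{1..s}. glm_b G j = post_b P j) \<and>
    (\<forall>i\<in>{2..s}.
      (\<forall>l\<in>{1..k-1}. glm_ahat G i l = core_ahat C i l) \<and>
      (\<forall>j\<in>{1..s}. glm_a G i j = core_a C i j) \<and>
      (\<forall>l\<in>{1..k-1}. glm_d G i l = core_d C i k * pre_d P l + core_d C i l) \<and>
      glm_d G i k = core_d C i k * pre_d P k)"
proof -
  from assms(2) have s: "s \<ge> 1" by simp
  show ?thesis
    by (intro exI[of _ "filtered_glm k C P"] conjI allI
        filtered_step_iff_glm_step[OF assms(1) s] glm_step_filtered_glm[OF s])
      (auto simp: filtered_glm_def)
qed

end
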